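(* Let $H$ and $K$ be complex inner product spaces with $\dim(H)\ge 2$, let $A:H\to K$ be a non-zero additive orthogonality preserving mapping, and let $\tilde K$ denote the completion of $K$. Then there exists a bounded real-linear mapping $R:\tilde K\to\tilde K$ such that $RA:H\to\tilde K$ is complex-linear and is a positive scalar multiple of a complex-linear isometry preserving orthogonality.
   Context: Here $K$ is regarded as a subspace of $\tilde K$ and $RA$ denotes the composition $x\mapsto R(A(x))$. A mapping $A:H\to K$ is additive if $A(x+y)=A(x)+A(y)$ for all $x,y\in H$. A mapping between inner product spaces preserves orthogonality if it sends any two vectors $x,y$ with $\langle x|y\rangle=0$ to two vectors with zero inner product. The dimension is the complex dimension; isometries are not assumed surjective. *)

theory Defs
  imports "HOL-Analysis.Analysis"
begin

text \<open>A complex inner product space is presented as a real inner product space carrying in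
  addition a complex scalar multiplication and a complex inner product, the real structure being the
  one they induce. This makes the library's norm, metric, topology, completeness and
  \<open>bounded_linear\<close> (which means bounded and real-linear) available. Positive definiteness of
  \<open>cinner\<close> is inherited from \<open>inner\<close>; see \<open>cinner_self\<close> below. The inner
  product is linear in its first argument.\<close>

class complex_inner = real_inner +
  fixes scaleC :: "complex \<Rightarrow> 'a \<Rightarrow> 'a"  (infixr \<open>*\<^sub>C\<close> 75)
    and cinner :: "'a \<Rightarrow> 'a \<Rightarrow> complex"
  assumes scaleC_add_right: "a *\<^sub>C (x + y) = a *\<^sub>C x + a *\<^sub>C y"
    and scaleC_add_left: "(a + b) *\<^sub>C x = a *\<^sub>C x + b *\<^sub>C x"
    and scaleC_scaleC: "a *\<^sub>C (b *\<^sub>C x) = (a * b) *\<^sub>C x"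
    and scaleC_one: "1 *\<^sub>C x = x"
    and scaleR_scaleC: "r *\<^sub>R x = complex_of_real r *\<^sub>C x"
    and cinner_commute: "cinner x y = cnj (cinner y x)"
    and cinner_add_left: "cinner (x + y) z = cinner x z + cinner y z"
    and cinner_scaleC_left: "cinner (a *\<^sub>C x) y = a * cinner x y"
    and inner_Re_cinner: "inner x y = Re (cinner x y)"

lemma cinner_self: "cinner x x = complex_of_real ((norm x)\<^sup>2)"
proof -
  have "Im (cinner x x) = - Im (cinner x x)"
    by (metis cinner_commute cnj.sel(2))
  then show ?thesis
    by (simp add: complex_eq_iff power2_norm_eq_inner inner_Re_cinner del: of_real_power)
qed

lemma cinner_self_eq_0_iff: "cinner x x = 0 \<longleftrightarrow> x = 0"
  by (simp add: cinner_self)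

instantiation complex :: complex_inner
begin
definition scaleC_complex_def: "scaleC (a::complex) (x::complex) = a * x"
definition cinner_complex_def: "cinner (x::complex) y = x * cnj y"
instance
  by standard
    (simp_all add: scaleC_complex_def cinner_complex_def inner_complex_def algebra_simps scaleR_conv_of_real)
end

global_interpretation complex_vector: vector_space "scaleC :: complex \<Rightarrow> 'a \<Rightarrow> 'a::complex_inner"
  defines cdependent = complex_vector.dependent
    and cspan = complex_vector.span
  by standard (simp_all add: scaleC_add_right scaleC_add_left scaleC_scaleC scaleC_one)

abbreviation clinear :: "('a::complex_inner \<Rightarrow> 'b::complex_inner) \<Rightarrow> bool"
  where "clinear \<equiv> Vector_Spaces.linear scaleC scaleC"

text \<open>The library's \<open>dim\<close> is \<open>0\<close> on infinite-dimensional spaces, so the bound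
  on the (Hamel) dimension is expressed through the cardinality of a basis.\<close>

definition cdim_at_least :: "nat \<Rightarrow> 'a::complex_inner itself \<Rightarrow> bool"
  where "cdim_at_least n (_ :: 'a itself) \<longleftrightarrow>
    (\<exists>B :: 'a set. \<not> cdependent B \<and> cspan B = UNIV \<and> (infinite B \<or> n \<le> card B))"

definition orthogonality_preserving :: "('a::complex_inner \<Rightarrow> 'b::complex_inner) \<Rightarrow> bool"
  where "orthogonality_preserving f \<longleftrightarrow> (\<forall>x y. cinner x y = 0 \<longrightarrow> cinner (f x) (f y) = 0)"

definition isometric :: "('a::metric_space \<Rightarrow> 'b::metric_space) \<Rightarrow> bool"
  where "isometric f \<longleftrightarrow> (\<forall>x y. dist (f x) (f y) = dist x y)"

text \<open>A completion of an inner product space is a complete inner product space together with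
  an embedding onto a dense subspace; it is unique up to a unique unitary compatible with the
  embeddings. The embedding plays the role of the inclusion of the space in its completion.\<close>

definition completion_embedding ::
    "('a::complex_inner \<Rightarrow> 'b::{complex_inner, complete_space}) \<Rightarrow> bool"
  where "completion_embedding \<iota> \<longleftrightarrow>
    clinear \<iota> \<and> (\<forall>x y. cinner (\<iota> x) (\<iota> y) = cinner x y) \<and> closure (range \<iota>) = UNIV"

end

theory Submission imports Defs begin

text \<open>An additive map \<open>A\<close> that preserves orthogonality has a Gram function: there are real
  numbers \<open>c\<close> and \<open>t\<close> with \<open>\<bar>t\<bar> \<le> c\<close> such that
  \<open>cinner (A x) (A y)\<close> has real part \<open>c * Re (cinner x y)\<close> and imaginary part
  \<open>t * Im (cinner x y)\<close>. Indeed, if \<open>x\<close> and \<open>y\<close> are orthogonal unit vectors, then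
  \<open>a x - a (cnj b) y\<close> is orthogonal to \<open>b x + y\<close>; applying \<open>A\<close> shows that the inner product of
  \<open>A (a x)\<close> and \<open>A (b x)\<close> depends only on \<open>a * cnj b\<close>. Decomposing along an orthogonal unit
  vector, which exists because the dimension is at least two, extends this to all pairs of
  vectors (\<open>gram_function_exists\<close>). The resulting function on the complex numbers is additive
  and non-negative on the non-negative reals, and additive functions with this positivity are
  real-linear; this gives the constants (\<open>gram_function_shape\<close>).

  Now split \<open>A\<close> into its complex-linear part \<open>A1 x = (A x - \<i> A (\<i> x)) / 2\<close> and its antilinear part
  \<open>A2 x = (A x + \<i> A (\<i> x)) / 2\<close>. The formula for the Gram function says that \<open>A1\<close> and \<open>A2\<close> have
  orthogonal ranges and that \<open>A1\<close> multiplies the inner product by \<open>(c + t) / 2\<close>. If \<open>c + t > 0\<close>,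
  the projection of the completion onto the orthogonal complement of the range of \<open>A2\<close> sends
  \<open>A x\<close> to \<open>A1 x\<close>, so this projection is the required map \<open>R\<close>. If \<open>c + t = 0\<close>, then \<open>A\<close> multiplies
  the inner product by \<open>c\<close> and conjugates it, and the required \<open>R\<close> is a conjugation of the
  completion, that is, an antilinear isometry (\<open>exists_linearizing_map\<close>).

  Both the projection and the conjugation are obtained by expanding a vector along a maximal
  orthonormal set \<open>E\<close>: they are the maps \<open>x \<mapsto> (\<Sum>\<^sub>\<infinity>e\<in>E. \<phi> (cinner x e) *\<^sub>C e)\<close> with \<open>\<phi>\<close> the
  identity or the complex conjugation. Completeness enters through the convergence of these
  sums (\<open>Riesz_Fischer\<close>).\<close>

section \<open>Complex inner products\<close>

lemma cinner_add_right: "cinner x (y + z) = cinner x y + cinner x z"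
  by (metis cinner_commute cinner_add_left complex_cnj_add)

lemma cinner_scaleC_right: "cinner x (a *\<^sub>C y) = cnj a * cinner x y"
  by (metis cinner_commute cinner_scaleC_left complex_cnj_mult)

lemma cinner_zero_left [simp]: "cinner 0 x = 0"
  using cinner_scaleC_left[of 0 x x] by simp

lemma cinner_zero_right [simp]: "cinner x 0 = 0"
  by (metis cinner_commute cinner_zero_left complex_cnj_zero)

lemma cinner_minus_left: "cinner (- x) y = - cinner x y"
  using cinner_add_left[of "- x" x y] by (simp add: eq_neg_iff_add_eq_0)

lemma cinner_minus_right: "cinner x (- y) = - cinner x y"
  by (metis cinner_commute cinner_minus_left complex_cnj_minus)

lemma cinner_diff_left: "cinner (x - y) z = cinner x z - cinner y z"
  using cinner_add_left[of x "- y" z] by (simp add: cinner_minus_left)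

lemma cinner_diff_right: "cinner x (y - z) = cinner x y - cinner x z"
  using cinner_add_right[of x y "- z"] by (simp add: cinner_minus_right)

lemma cinner_scaleR_left: "cinner (r *\<^sub>R x) y = r *\<^sub>R cinner x y"
  by (simp only: scaleR_scaleC cinner_scaleC_left scaleC_complex_def)

lemma cinner_sum_left: "cinner (\<Sum>i\<in>I. f i) y = (\<Sum>i\<in>I. cinner (f i) y)"
  by (induction I rule: infinite_finite_induct) (simp_all add: cinner_add_left)

lemmas cinner_algebra =
  cinner_add_left cinner_add_right cinner_diff_left cinner_diff_right
  cinner_scaleC_left cinner_scaleC_right

lemma cinner_eq_0_commute: "cinner x y = 0 \<longleftrightarrow> cinner y x = 0"
  by (metis cinner_commute complex_cnj_zero)

lemma norm_scaleC: "norm (a *\<^sub>C x) = cmod a * norm x"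
proof -
  have "complex_of_real ((norm (a *\<^sub>C x))\<^sup>2) = (a * cnj a) * cinner x x"
    by (simp only: cinner_self[symmetric] cinner_scaleC_left cinner_scaleC_right mult_ac)
  also have "\<dots> = complex_of_real ((cmod a * norm x)\<^sup>2)"
    by (simp only: complex_norm_square[symmetric] cinner_self power_mult_distrib of_real_mult)
  finally have "(norm (a *\<^sub>C x))\<^sup>2 = (cmod a * norm x)\<^sup>2"
    using of_real_eq_iff by blast
  then show ?thesis by simp
qed

text \<open>Rotating the first vector turns the inner product into a non-negative real number, so this
  complex Cauchy-Schwarz inequality reduces to the real one.\<close>

lemma cmod_cinner_le: "cmod (cinner x y) \<le> norm x * norm y"
proof -
  define u where "u = cnj (sgn (cinner x y))"
  have "u * cinner x y = complex_of_real (cmod (cinner x y))"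
    by (cases "cinner x y = 0")
       (auto simp: u_def sgn_eq field_simps complex_norm_square[symmetric] power2_eq_square)
  then have "cmod (cinner x y) = inner (u *\<^sub>C x) y"
    by (simp add: inner_Re_cinner cinner_scaleC_left)
  also have "\<dots> \<le> norm (u *\<^sub>C x) * norm y"
    by (rule norm_cauchy_schwarz)
  also have "\<dots> \<le> norm x * norm y"
    by (auto simp: norm_scaleC u_def norm_sgn mult_le_cancel_right1 intro!: mult_right_mono)
  finally show ?thesis .
qed

lemma bounded_linear_cinner_left: "bounded_linear (\<lambda>x. cinner x y)"
  by (rule bounded_linear_intro[where K = "norm y"])
     (auto simp: cinner_add_left cinner_scaleR_left cmod_cinner_le)

lemma clinear_iff:
  "clinear f \<longleftrightarrow> (\<forall>x y. f (x + y) = f x + f y) \<and> (\<forall>a x. f (a *\<^sub>C x) = a *\<^sub>C f x)"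
  by (auto simp: Vector_Spaces.linear_iff complex_vector.vector_space_axioms)

section \<open>Orthonormal sets in complete spaces\<close>

definition orthonormal :: "'a::complex_inner set \<Rightarrow> bool"
  where "orthonormal E \<longleftrightarrow> (\<forall>e\<in>E. \<forall>f\<in>E. cinner e f = (if e = f then 1 else 0))"

lemma cinner_sum_orthonormal:
  assumes "orthonormal E" "finite F" "F \<subseteq> E" "f \<in> E"
  shows "cinner (\<Sum>e\<in>F. c e *\<^sub>C e) f = (if f \<in> F then c f else 0)"
proof -
  have "cinner (\<Sum>e\<in>F. c e *\<^sub>C e) f = (\<Sum>e\<in>F. cinner (c e *\<^sub>C e) f)"
    by (rule cinner_sum_left)
  also have "\<dots> = (\<Sum>e\<in>F. if e = f then c e else 0)"
    using assms by (intro sum.cong) (auto simp: orthonormal_def cinner_scaleC_left)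
  finally show ?thesis using assms(2) by simp
qed

lemma norm_sum_orthonormal:
  assumes "orthonormal E" "finite F" "F \<subseteq> E"
  shows "(norm (\<Sum>e\<in>F. c e *\<^sub>C e))\<^sup>2 = (\<Sum>e\<in>F. (cmod (c e))\<^sup>2)"
proof -
  let ?s = "\<Sum>e\<in>F. c e *\<^sub>C e"
  have "complex_of_real ((norm ?s)\<^sup>2) = (\<Sum>e\<in>F. cinner (c e *\<^sub>C e) ?s)"
    unfolding cinner_self[symmetric] by (rule cinner_sum_left)
  also have "\<dots> = (\<Sum>e\<in>F. c e * cnj (cinner ?s e))"
    by (intro sum.cong refl) (metis cinner_scaleC_left cinner_commute)
  also have "\<dots> = (\<Sum>e\<in>F. c e * cnj (c e))"
    using assms by (intro sum.cong refl) (subst cinner_sum_orthonormal[OF assms], auto)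
  also have "\<dots> = complex_of_real (\<Sum>e\<in>F. (cmod (c e))\<^sup>2)"
    by (simp only: complex_norm_square of_real_sum)
  finally show ?thesis using of_real_eq_iff by blast
qed

text \<open>Bessel's inequality: the partial expansion of \<open>x\<close> is orthogonal to the remainder, so it is
  no longer than \<open>x\<close> by the theorem of Pythagoras.\<close>

lemma Bessel:
  assumes "orthonormal E" "finite F" "F \<subseteq> E"
  shows "(\<Sum>e\<in>F. (cmod (cinner x e))\<^sup>2) \<le> (norm x)\<^sup>2"
proof -
  let ?s = "\<Sum>e\<in>F. cinner x e *\<^sub>C e"
  have "cinner ?s (x - ?s) = (\<Sum>e\<in>F. cinner (cinner x e *\<^sub>C e) (x - ?s))"
    by (rule cinner_sum_left)
  also have "\<dots> = 0"
  proof (intro sum.neutral ballI)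
    fix e assume "e \<in> F"
    then have "cinner (x - ?s) e = 0"
      using assms by (simp add: cinner_diff_left cinner_sum_orthonormal subset_iff)
    then show "cinner (cinner x e *\<^sub>C e) (x - ?s) = 0"
      by (simp add: cinner_scaleC_left cinner_eq_0_commute)
  qed
  finally have "inner ?s (x - ?s) = 0" by (simp add: inner_Re_cinner)
  then have "(norm (?s + (x - ?s)))\<^sup>2 = (norm ?s)\<^sup>2 + (norm (x - ?s))\<^sup>2"
    by (rule norm_add_Pythagorean[unfolded orthogonal_def])
  then show ?thesis using norm_sum_orthonormal[OF assms, of "cinner x"] by simp
qed

text \<open>By Pythagoras, the distance between two partial sums is controlled by the corresponding
  partial sums of the squared coefficients. Boundedness makes these converge, hence the partial
  sums of the vectors are Cauchy.\<close>

lemma Riesz_Fischer: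
  fixes E :: "'a::{complex_inner, complete_space} set"
  assumes E: "orthonormal E"
    and bound: "\<And>F. finite F \<Longrightarrow> F \<subseteq> E \<Longrightarrow> (\<Sum>e\<in>F. (cmod (c e))\<^sup>2) \<le> B"
  shows "(\<lambda>e. c e *\<^sub>C e) summable_on E"
proof -
  let ?g = "\<lambda>e. (cmod (c e))\<^sup>2" and ?f = "\<lambda>e. c e *\<^sub>C e"
  have "?g summable_on E"
    by (rule nonneg_bdd_above_summable_on) (auto intro!: bdd_aboveI[of _ B] bound)
  then obtain L where L: "(sum ?g \<longlongrightarrow> L) (finite_subsets_at_top E)"
    unfolding summable_on_def has_sum_def by blast
  have "\<exists>P. eventually P (finite_subsets_at_top E) \<and>
      (\<forall>F F'. P F \<and> P F' \<longrightarrow> dist (sum ?f F) (sum ?f F') < \<epsilon>)" if "\<epsilon> > 0" for \<epsilon>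
  proof -
    have "0 < (\<epsilon>/2)\<^sup>2 / 2" using that by simp
    then have "\<forall>\<^sub>F F in finite_subsets_at_top E. dist (sum ?g F) L < (\<epsilon>/2)\<^sup>2 / 2"
      using L unfolding tendsto_iff by blast
    then obtain F0 where F0: "finite F0" "F0 \<subseteq> E"
      and near: "\<forall>F. finite F \<and> F0 \<subseteq> F \<and> F \<subseteq> E \<longrightarrow> dist (sum ?g F) L < (\<epsilon>/2)\<^sup>2 / 2"
      unfolding eventually_finite_subsets_at_top by (elim exE conjE)
    have half: "dist (sum ?f F) (sum ?f F0) < \<epsilon>/2" if F: "finite F" "F0 \<subseteq> F" "F \<subseteq> E" for F
    proof -
      have "(dist (sum ?f F) (sum ?f F0))\<^sup>2 = (norm (sum ?f (F - F0)))\<^sup>2"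
        using F by (simp add: dist_norm sum_diff)
      also have "\<dots> = sum ?g (F - F0)"
        using F by (intro norm_sum_orthonormal[OF E]) auto
      also have "\<dots> = sum ?g F - sum ?g F0"
        using F by (simp add: sum_diff)
      also have "\<dots> < (\<epsilon>/2)\<^sup>2"
        using near[rule_format, OF conjI[OF F(1) conjI[OF F(2,3)]]]
          near[rule_format, OF conjI[OF F0(1) conjI[OF order_refl F0(2)]]]
        unfolding dist_real_def by linarith
      finally show ?thesis using \<open>\<epsilon> > 0\<close> by (intro power_less_imp_less_base[of _ 2 "\<epsilon>/2"]) simp_all
    qed
    show ?thesis
    proof (intro exI conjI allI impI)
      show "\<forall>\<^sub>F F in finite_subsets_at_top E. finite F \<and> F0 \<subseteq> F \<and> F \<subseteq> E"
        using F0 by (auto simp: eventually_finite_subsets_at_top)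
      fix F F'
      assume "(finite F \<and> F0 \<subseteq> F \<and> F \<subseteq> E) \<and> finite F' \<and> F0 \<subseteq> F' \<and> F' \<subseteq> E"
      then show "dist (sum ?f F) (sum ?f F') < \<epsilon>"
        using half[of F] half[of F'] dist_triangle_half_l[of "sum ?f F" "sum ?f F0" \<epsilon> "sum ?f F'"]
        by (simp add: dist_commute)
    qed
  qed
  then have "cauchy_filter (filtermap (sum ?f) (finite_subsets_at_top E))"
    by (simp add: cauchy_filter_metric_filtermap)
  moreover have "complete (UNIV :: 'a set)"
    by (meson Cauchy_convergent UNIV_I complete_def convergent_def)
  ultimately obtain s where "(sum ?f \<longlongrightarrow> s) (finite_subsets_at_top E)"
    using cauchy_filter_complete_converges[of "filtermap (sum ?f) (finite_subsets_at_top E)" UNIV]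
    by (auto simp: filterlim_def filtermap_bot_iff)
  then show ?thesis unfolding summable_on_def has_sum_def by blast
qed

text \<open>Zorn's lemma, applied inside the orthogonal complement of \<open>S\<close>. A nonzero vector orthogonal to
  \<open>S\<close> and to a maximal \<open>E\<close> could be normalised and added to \<open>E\<close>. With \<open>S\<close> empty this gives a total
  orthonormal set of the whole space.\<close>

lemma maximal_orthonormal_exists:
  obtains E where "orthonormal E"
    and "\<forall>e\<in>E. \<forall>s\<in>S. cinner e s = 0"
    and "\<forall>z. (\<forall>s\<in>S. cinner z s = 0) \<longrightarrow> (\<forall>e\<in>E. cinner z e = 0) \<longrightarrow> z = 0"
proof -
  let ?A = "{E. orthonormal E \<and> (\<forall>e\<in>E. \<forall>s\<in>S. cinner e s = 0)}"
  have "\<exists>E\<in>?A. \<forall>X\<in>?A. E \<subseteq> X \<longrightarrow> X = E"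
  proof (rule subset_Zorn')
    fix C assume C: "subset.chain ?A C"
    have "orthonormal (\<Union>C)"
      unfolding orthonormal_def
    proof (intro ballI)
      fix e f assume "e \<in> \<Union>C" "f \<in> \<Union>C"
      then obtain X Y where "X \<in> C" "e \<in> X" "Y \<in> C" "f \<in> Y" by (elim UnionE)
      moreover from this have "X \<subseteq> Y \<or> Y \<subseteq> X"
        using C unfolding subset_chain_def by simp
      ultimately obtain X where "X \<in> C" "e \<in> X" "f \<in> X" by (metis subsetD)
      moreover from this have "orthonormal X"
        using C unfolding subset_chain_def by blast
      ultimately show "cinner e f = (if e = f then 1 else 0)"
        unfolding orthonormal_def by blast
    qed
    moreover have "C \<subseteq> ?A" using C by (simp only: subset_chain_def)
    ultimately show "\<Union>C \<in> ?A" by auto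
  qed
  then obtain E where E: "E \<in> ?A" and max: "\<forall>X\<in>?A. E \<subseteq> X \<longrightarrow> X = E"
    by (rule bexE)
  have total: "z = 0" if z: "\<forall>s\<in>S. cinner z s = 0" "\<forall>e\<in>E. cinner z e = 0" for z
  proof (rule ccontr)
    assume "z \<noteq> 0"
    define w where "w = inverse (norm z) *\<^sub>R z"
    have w: "cinner w w = 1"
      using \<open>z \<noteq> 0\<close> by (simp add: w_def cinner_self)
    have wE: "cinner w e = 0" "cinner e w = 0" if "e \<in> E" for e
      using z that cinner_eq_0_commute[of e w] by (simp_all add: w_def cinner_scaleR_left)
    have wS: "cinner w s = 0" if "s \<in> S" for s
      using z that by (simp add: w_def cinner_scaleR_left)
    have "w \<notin> E"
      using w wE(1)[of w] by (cases "w \<in> E") simp_all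
    then have "insert w E \<in> ?A"
      using E w wE wS by (auto simp: orthonormal_def)
    then have "insert w E = E" using max by (meson subset_insertI)
    then show False using \<open>w \<notin> E\<close> by (metis insertI1)
  qed
  show ?thesis
  proof (rule that)
    show "orthonormal E" using E by simp
    show "\<forall>e\<in>E. \<forall>s\<in>S. cinner e s = 0" using E by simp
    show "\<forall>z. (\<forall>s\<in>S. cinner z s = 0) \<longrightarrow> (\<forall>e\<in>E. cinner z e = 0) \<longrightarrow> z = 0"
    proof (intro allI impI)
      fix z assume "\<forall>s\<in>S. cinner z s = 0" "\<forall>e\<in>E. cinner z e = 0"
      then show "z = 0" by (rule total)
    qed
  qed
qed

text \<open>With \<open>\<phi>\<close> the identity this is the orthogonal projection onto the closed span of \<open>E\<close>; with \<open>\<phi>\<close>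
  the complex conjugation it is an antilinear map fixing \<open>E\<close>. Treating both at once avoids proving
  convergence, boundedness and the formula for the coefficients twice.\<close>

definition expansion :: "(complex \<Rightarrow> complex) \<Rightarrow> 'a::complex_inner set \<Rightarrow> 'a \<Rightarrow> 'a"
  where "expansion \<phi> E x = (\<Sum>\<^sub>\<infinity>e\<in>E. \<phi> (cinner x e) *\<^sub>C e)"

context
  fixes \<phi> :: "complex \<Rightarrow> complex" and E :: "'a::{complex_inner, complete_space} set"
  assumes linear: "linear \<phi>" and cmod: "\<And>a. cmod (\<phi> a) = cmod a" and E: "orthonormal E"
begin

lemma has_sum_expansion: "((\<lambda>e. \<phi> (cinner x e) *\<^sub>C e) has_sum expansion \<phi> E x) E"
  unfolding expansion_def
  by (intro has_sum_infsum Riesz_Fischer[OF E, where B = "(norm x)\<^sup>2"])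
     (simp add: cmod Bessel[OF E])

lemma cinner_expansion:
  assumes "e \<in> E"
  shows "cinner (expansion \<phi> E x) e = \<phi> (cinner x e)"
proof -
  have "((\<lambda>f. cinner (\<phi> (cinner x f) *\<^sub>C f) e) has_sum cinner (expansion \<phi> E x) e) E"
    by (rule has_sum_bounded_linear[OF bounded_linear_cinner_left has_sum_expansion])
  moreover have "((\<lambda>f. cinner (\<phi> (cinner x f) *\<^sub>C f) e) has_sum \<phi> (cinner x e)) E"
    using assms E
    by (intro has_sum_finite_neutralI[where B = "{e}"])
       (auto simp: orthonormal_def cinner_scaleC_left)
  ultimately show ?thesis by (rule has_sum_unique)
qed

lemma norm_expansion_le: "norm (expansion \<phi> E x) \<le> norm x"
proof (rule tendsto_upperbound)
  let ?f = "\<lambda>e. \<phi> (cinner x e) *\<^sub>C e"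
  show "((\<lambda>F. norm (sum ?f F)) \<longlongrightarrow> norm (expansion \<phi> E x)) (finite_subsets_at_top E)"
    using has_sum_expansion[of x] unfolding has_sum_def by (rule tendsto_norm)
  have "norm (sum ?f F) \<le> norm x" if "finite F" "F \<subseteq> E" for F
  proof (rule power2_le_imp_le)
    show "(norm (sum ?f F))\<^sup>2 \<le> (norm x)\<^sup>2"
      using Bessel[OF E that, of x] by (simp add: norm_sum_orthonormal[OF E that] cmod)
  qed simp
  then show "\<forall>\<^sub>F F in finite_subsets_at_top E. norm (sum ?f F) \<le> norm x"
    by (intro eventually_finite_subsets_at_top_weakI)
qed simp

lemma bounded_linear_expansion: "bounded_linear (expansion \<phi> E)"
proof (rule bounded_linear_intro[where K = 1])
  fix x y r
  have "((\<lambda>e. \<phi> (cinner (x + y) e) *\<^sub>C e) has_sum (expansion \<phi> E x + expansion \<phi> E y)) E"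
    using has_sum_add[OF has_sum_expansion has_sum_expansion, of x y]
    by (simp add: cinner_add_left linear_add[OF linear] scaleC_add_left)
  then show "expansion \<phi> E (x + y) = expansion \<phi> E x + expansion \<phi> E y"
    by (rule has_sum_unique[OF has_sum_expansion])
  have "((\<lambda>e. r *\<^sub>R (\<phi> (cinner x e) *\<^sub>C e)) has_sum (r *\<^sub>R expansion \<phi> E x)) E"
    by (rule has_sum_bounded_linear[OF bounded_linear_scaleR_right has_sum_expansion])
  moreover have "r *\<^sub>R (\<phi> (cinner x e) *\<^sub>C e) = \<phi> (cinner (r *\<^sub>R x) e) *\<^sub>C e" for e
    unfolding cinner_scaleR_left linear_scale[OF linear]
    by (simp only: scaleR_scaleC scaleC_scaleC scaleC_complex_def)
  ultimately have "((\<lambda>e. \<phi> (cinner (r *\<^sub>R x) e) *\<^sub>C e) has_sum (r *\<^sub>R expansion \<phi> E x)) E"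
    by simp
  then show "expansion \<phi> E (r *\<^sub>R x) = r *\<^sub>R expansion \<phi> E x"
    by (rule has_sum_unique[OF has_sum_expansion])
qed (simp add: norm_expansion_le)

end

text \<open>Expand along an orthonormal set that is maximal in the orthogonal complement of \<open>S\<close>. For \<open>x\<close> in
  this complement, \<open>P x - x\<close> is orthogonal to \<open>S\<close> and has vanishing coefficients, so maximality
  forces it to be zero. Working with the complement of an arbitrary set, which is automatically a
  closed subspace, makes any closure operation unnecessary.\<close>

lemma orthogonal_projection_exists:
  fixes S :: "'a::{complex_inner, complete_space} set"
  obtains P where "bounded_linear P"
    and "\<forall>x. (\<forall>s\<in>S. cinner x s = 0) \<longrightarrow> P x = x"
    and "\<forall>s\<in>S. P s = 0"
proof -
  obtain E where E: "orthonormal E" and ES: "\<forall>e\<in>E. \<forall>s\<in>S. cinner e s = 0"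
    and total: "\<forall>z. (\<forall>s\<in>S. cinner z s = 0) \<longrightarrow> (\<forall>e\<in>E. cinner z e = 0) \<longrightarrow> z = 0"
    by (rule maximal_orthonormal_exists[of S])
  define P where "P = expansion id E"
  have id: "linear (id :: complex \<Rightarrow> complex)" "\<And>a. cmod (id a) = cmod a"
    by (simp_all add: linear_id)
  note facts = has_sum_expansion[OF id E] cinner_expansion[OF id E]
  have "P x = x" if x: "\<forall>s\<in>S. cinner x s = 0" for x
  proof -
    have "cinner (P x) s = 0" if "s \<in> S" for s
    proof (rule has_sum_unique)
      show "((\<lambda>e. cinner (id (cinner x e) *\<^sub>C e) s) has_sum cinner (P x) s) E"
        unfolding P_def by (rule has_sum_bounded_linear[OF bounded_linear_cinner_left facts(1)])
      show "((\<lambda>e. cinner (id (cinner x e) *\<^sub>C e) s) has_sum 0) E"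
        using that by (intro has_sum_0) (simp add: cinner_scaleC_left ES)
    qed
    then have "P x - x = 0"
      using x by (intro total[rule_format]) (simp_all add: cinner_diff_left P_def facts(2))
    then show ?thesis by simp
  qed
  moreover have "P s = 0" if "s \<in> S" for s
    unfolding P_def expansion_def
  proof (rule infsum_0)
    fix e assume "e \<in> E"
    then have "cinner s e = 0" using ES that cinner_eq_0_commute[of s e] by simp
    then show "id (cinner s e) *\<^sub>C e = 0" by simp
  qed
  moreover have "bounded_linear P"
    unfolding P_def by (rule bounded_linear_expansion[OF id E])
  ultimately show ?thesis by (intro that[of P] allI impI ballI)
qed

text \<open>A vector is determined by its coefficients along a total orthonormal set, and \<open>J\<close> conjugates
  these; so \<open>J\<close> is antilinear and an involution. An involution that does not increase
  norms preserves them, and polarisation turns this into the formula for inner products.\<close>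

lemma conjugation_exists:
  obtains J :: "'a \<Rightarrow> 'a::{complex_inner, complete_space}"
  where "bounded_linear J" and "\<forall>x y. cinner (J x) (J y) = cnj (cinner x y)"
proof -
  obtain E :: "'a set" where E: "orthonormal E"
    and "\<forall>e\<in>E. \<forall>s\<in>{}. cinner e s = 0"
    and total: "\<forall>z. (\<forall>s\<in>{}. cinner z s = 0) \<longrightarrow> (\<forall>e\<in>E. cinner z e = 0) \<longrightarrow> z = 0"
    by (rule maximal_orthonormal_exists[of "{}"])
  define J where "J = expansion cnj E"
  have cnj: "linear cnj" "\<And>a. cmod (cnj a) = cmod a"
    by (simp_all add: bounded_linear.linear bounded_linear_cnj)
  have coeff: "cinner (J x) e = cnj (cinner x e)" if "e \<in> E" for x e
    unfolding J_def by (rule cinner_expansion[OF cnj E that])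
  have J: "bounded_linear J"
    unfolding J_def by (rule bounded_linear_expansion[OF cnj E])
  have le: "norm (J x) \<le> norm x" for x
    unfolding J_def by (rule norm_expansion_le[OF cnj E])
  have "J (J x) - x = 0" for x
    by (rule total[rule_format]) (simp_all add: cinner_diff_left coeff)
  then have norm: "norm (J x) = norm x" for x
    using le[of x] le[of "J x"] by simp
  have "J (a *\<^sub>C x) - cnj a *\<^sub>C J x = 0" for a x
    by (rule total[rule_format]) (simp_all add: cinner_diff_left cinner_scaleC_left coeff)
  then have scale: "J (a *\<^sub>C x) = cnj a *\<^sub>C J x" for a x by simp
  have inner: "inner (J x) (J y) = inner x y" for x y
    using dot_norm[of "J x" "J y"] dot_norm[of x y]
    by (simp add: norm flip: linear_add[OF bounded_linear.linear[OF J]])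
  have "cinner (J x) (J y) = cnj (cinner x y)" for x y
  proof (rule complex_eqI)
    show "Re (cinner (J x) (J y)) = Re (cnj (cinner x y))"
      using inner[of x y] by (simp add: inner_Re_cinner)
    have "Im (cinner (J x) (J y)) = - inner (J x) (J (\<i> *\<^sub>C y))"
      by (simp add: scale inner_Re_cinner cinner_scaleC_right cinner_minus_right)
    also have "\<dots> = Im (cnj (cinner x y))"
      unfolding inner by (simp add: inner_Re_cinner cinner_scaleC_right)
    finally show "Im (cinner (J x) (J y)) = Im (cnj (cinner x y))" .
  qed
  with J show ?thesis by (intro that[of J] allI)
qed

section \<open>Gram matrices of orthogonality preserving maps\<close>

text \<open>Such a function is monotone. Enclosing \<open>n * r\<close> between consecutive integers, on which \<open>f\<close> is
  known, shows that \<open>n * (f r - r * f 1)\<close> stays bounded by \<open>f 1\<close> for all \<open>n\<close>.\<close>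

lemma additive_nonneg_imp_homogeneous:
  fixes f :: "real \<Rightarrow> real"
  assumes "Modules.additive f" and nonneg: "\<And>r. 0 \<le> r \<Longrightarrow> 0 \<le> f r"
  shows "f r = r * f 1"
proof -
  interpret f: Modules.additive f by fact
  have nat: "f (of_nat n * r) = of_nat n * f r" for n r
    by (induction n) (simp_all add: f.zero f.add distrib_right)
  have int: "f (of_int k) = of_int k * f 1" for k
  proof (cases k rule: int_cases2)
    case (nonneg n)
    then show ?thesis using nat[of n 1] by simp
  next
    case (nonpos n)
    then show ?thesis using nat[of n 1] f.minus[of "of_nat n"] by simp
  qed
  have mono: "f a \<le> f b" if "a \<le> b" for a b
    using nonneg[of "b - a"] that by (simp add: f.diff)
  have bound: "of_nat n * \<bar>f r - r * f 1\<bar> \<le> f 1" for n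
  proof -
    define k where "k = \<lfloor>of_nat n * r\<rfloor>"
    have k: "of_int k \<le> of_nat n * r" "of_nat n * r \<le> of_int (k + 1)"
      unfolding k_def by linarith+
    have "of_int k * f 1 \<le> of_nat n * f r" "of_nat n * f r \<le> of_int (k + 1) * f 1"
      using mono[OF k(1)] mono[OF k(2)] by (simp_all only: int nat)
    moreover have "of_int k * f 1 \<le> (of_nat n * r) * f 1"
      "(of_nat n * r) * f 1 \<le> of_int (k + 1) * f 1"
      using k nonneg[of 1] by (auto intro!: mult_right_mono)
    moreover have "of_int (k + 1) * f 1 = of_int k * f 1 + f 1"
      by (simp add: distrib_right)
    ultimately have "\<bar>of_nat n * f r - (of_nat n * r) * f 1\<bar> \<le> f 1" by linarith
    moreover have "of_nat n * f r - (of_nat n * r) * f 1 = of_nat n * (f r - r * f 1)"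
      by (simp add: right_diff_distrib)
    ultimately show ?thesis by (simp add: abs_mult)
  qed
  show ?thesis
  proof (rule ccontr)
    assume "f r \<noteq> r * f 1"
    then obtain n where "f 1 < of_nat n * \<bar>f r - r * f 1\<bar>"
      using reals_Archimedean3[of "\<bar>f r - r * f 1\<bar>"] by auto
    then show False using bound[of n] by simp
  qed
qed

lemma orthogonal_unit_vector_exists:
  fixes e :: "'h::complex_inner"
  assumes "cdim_at_least 2 TYPE('h)"
  obtains f :: 'h where "norm f = 1" "cinner f e = 0"
proof -
  obtain B :: "'h set" where B: "\<not> cdependent B" "cspan B = UNIV" "infinite B \<or> 2 \<le> card B"
    using assms unfolding cdim_at_least_def by (elim exE conjE)
  have "cspan {e} \<noteq> UNIV"
  proof
    assume "cspan {e} = UNIV"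
    then have "finite B \<and> card B \<le> card {e}"
      using B(1) by (intro complex_vector.independent_span_bound) simp_all
    then show False using B(3) by simp
  qed
  then obtain v where v: "v \<notin> cspan {e}" by auto
  define w where "w = v - (cinner v e / cinner e e) *\<^sub>C e"
  have "w \<noteq> 0"
  proof
    assume "w = 0"
    then have "v = (cinner v e / cinner e e) *\<^sub>C e" by (simp add: w_def)
    also have "\<dots> \<in> cspan {e}"
      by (intro complex_vector.span_scale complex_vector.span_base) simp
    finally show False using v by simp
  qed
  have "cinner w e = 0"
    by (cases "e = 0")
       (simp_all add: w_def cinner_diff_left cinner_scaleC_left cinner_self_eq_0_iff)
  show ?thesis
  proof (rule that)
    show "norm (inverse (norm w) *\<^sub>R w) = 1" using \<open>w \<noteq> 0\<close> by simp
    show "cinner (inverse (norm w) *\<^sub>R w) e = 0"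
      by (simp only: cinner_scaleR_left \<open>cinner w e = 0\<close> scaleR_zero_right)
  qed
qed

lemma cinner_self_unit: "norm x = 1 \<Longrightarrow> cinner x x = 1"
  by (simp add: cinner_self)

text \<open>The proof first treats multiples of one unit vector \<open>u\<close>, with \<open>h u\<close> as the candidate. The
  function \<open>h u\<close> is the same for orthogonal unit vectors \<open>u\<close>, and then for all unit vectors by
  writing one of them in terms of another and a vector orthogonal to it. For general \<open>x\<close> and \<open>y\<close>,
  only the component of \<open>x\<close> along \<open>y\<close> contributes.\<close>

lemma gram_function_exists:
  fixes A :: "'h::complex_inner \<Rightarrow> 'k::complex_inner"
  assumes dim: "cdim_at_least 2 TYPE('h)" and "Modules.additive A"
    and A: "orthogonality_preserving A"
  obtains h where "\<forall>x y. cinner (A x) (A y) = h (cinner x y)"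
proof -
  interpret A: Modules.additive A by fact
  have orth: "cinner (A x) (A y) = 0" if "cinner x y = 0" for x y
    using A that unfolding orthogonality_preserving_def by simp
  have move: "cinner (A (a *\<^sub>C x)) (A (b *\<^sub>C x)) = cinner (A ((a * cnj b) *\<^sub>C y)) (A y)"
    if "norm x = 1" "norm y = 1" and xy: "cinner x y = 0" for a b x y
  proof -
    let ?s = "a * cnj b"
    \<comment> \<open>The coefficient of the first \<open>y\<close> is chosen such that the two contributions cancel.\<close>
    have yx: "cinner y x = 0" using xy cinner_eq_0_commute by blast
    have "cinner (a *\<^sub>C x - ?s *\<^sub>C y) (b *\<^sub>C x + y) = 0"
      using that by (simp add: cinner_algebra yx cinner_self_unit)
    then have "cinner (A (a *\<^sub>C x) - A (?s *\<^sub>C y)) (A (b *\<^sub>C x) + A y) = 0"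
      using orth by (simp flip: A.add A.diff)
    moreover have "cinner (A (a *\<^sub>C x)) (A y) = 0" "cinner (A (?s *\<^sub>C y)) (A (b *\<^sub>C x)) = 0"
      by (rule orth, simp add: cinner_algebra xy yx)+
    ultimately show ?thesis by (simp add: cinner_algebra)
  qed
  define h where "h u s = cinner (A (s *\<^sub>C u)) (A u)" for u s
  have h_add: "h u (s + t) = h u s + h u t" for u s t
    by (simp add: h_def scaleC_add_left A.add cinner_add_left)
  have h_orth: "h u s = h v s" if "norm u = 1" "norm v = 1" "cinner u v = 0" for u v s
    using move[OF that, of s 1] by (simp add: h_def scaleC_one)
  have diag: "cinner (A (a *\<^sub>C u)) (A (b *\<^sub>C u)) = h u (a * cnj b)" if u: "norm u = 1" for a b u
  proof -
    obtain v where v: "norm v = 1" "cinner v u = 0"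
      using orthogonal_unit_vector_exists[OF dim] by blast
    then have uv: "cinner u v = 0" using cinner_eq_0_commute by blast
    show ?thesis
      using move[OF u v(1) uv, of a b] h_orth[OF u v(1) uv] by (simp add: h_def)
  qed
  obtain e :: 'h where e: "norm e = 1"
    using orthogonal_unit_vector_exists[OF dim] by blast
  have h_unit: "h u s = h e s" if u: "norm u = 1" for u s
  proof -
    define l where "l = cinner u e"
    define w where "w = u - l *\<^sub>C e"
    have we: "cinner w e = 0"
      using e by (simp add: w_def l_def cinner_algebra cinner_self_unit)
    obtain f m where f: "norm f = 1" "cinner f e = 0" and w: "w = m *\<^sub>C f"
    proof (cases "w = 0")
      case True
      obtain f :: 'h where "norm f = 1" "cinner f e = 0"
        using orthogonal_unit_vector_exists[OF dim] by blast
      with True show ?thesis by (intro that[of f 0]) simp_all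
    next
      case False
      show ?thesis
      proof (rule that)
        show "norm (inverse (norm w) *\<^sub>R w) = 1" using False by simp
        show "cinner (inverse (norm w) *\<^sub>R w) e = 0"
          by (simp only: cinner_scaleR_left we scaleR_zero_right)
        show "w = complex_of_real (norm w) *\<^sub>C (inverse (norm w) *\<^sub>R w)"
          using False by (simp flip: scaleR_scaleC)
      qed
    qed
    have ef: "cinner e f = 0" using f(2) cinner_eq_0_commute by blast
    have u_eq: "u = l *\<^sub>C e + m *\<^sub>C f" using w by (simp add: w_def diff_eq_eq add.commute)
    have "cinner u u = l * cnj l + m * cnj m"
      by (simp add: u_eq cinner_algebra cinner_self_unit e f ef)
    then have one: "l * cnj l + m * cnj m = 1" using u by (simp add: cinner_self_unit)
    have cross: "cinner (A (a *\<^sub>C e)) (A (b *\<^sub>C f)) = 0" "cinner (A (b *\<^sub>C f)) (A (a *\<^sub>C e)) = 0"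
      for a b by (rule orth, simp add: cinner_algebra f ef)+
    have "h u s = cinner (A ((s * l) *\<^sub>C e) + A ((s * m) *\<^sub>C f)) (A (l *\<^sub>C e) + A (m *\<^sub>C f))"
      by (simp add: h_def u_eq scaleC_add_right scaleC_scaleC A.add)
    also have "\<dots> = h e (s * l * cnj l) + h f (s * m * cnj m)"
      by (simp add: cinner_add_left cinner_add_right cross diag e f)
    also have "\<dots> = h e (s * l * cnj l + s * m * cnj m)"
      by (simp add: h_orth[OF f(1) e f(2)] h_add)
    also have "s * l * cnj l + s * m * cnj m = s"
      by (simp only: mult.assoc one mult_1_right flip: distrib_left)
    finally show ?thesis .
  qed
  have "cinner (A x) (A y) = h e (cinner x y)" for x y
  proof (cases "y = 0")
    case True
    then show ?thesis by (simp add: h_def A.zero)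
  next
    case False
    define u where "u = inverse (norm y) *\<^sub>R y"
    define m where "m = complex_of_real (norm y)"
    define c where "c = cinner x u"
    define z where "z = x - c *\<^sub>C u"
    have u: "norm u = 1" using False by (simp add: u_def)
    have y: "y = m *\<^sub>C u" using False by (simp add: u_def m_def flip: scaleR_scaleC)
    have x: "x = c *\<^sub>C u + z" by (simp add: z_def)
    have zu: "cinner z u = 0"
      by (simp add: z_def c_def cinner_algebra cinner_self_unit u)
    have "cinner (A z) (A y) = 0"
      by (rule orth) (simp add: y cinner_algebra zu)
    then have "cinner (A x) (A y) = cinner (A (c *\<^sub>C u)) (A (m *\<^sub>C u))"
      by (simp add: x y A.add cinner_add_left)
    also have "\<dots> = h e (c * cnj m)" by (simp add: diag[OF u] h_unit[OF u])
    also have "c * cnj m = cinner x y"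
      by (simp add: y c_def cinner_scaleC_right mult.commute)
    finally show ?thesis .
  qed
  then show ?thesis by (intro that[of "h e"] allI)
qed

text \<open>Both real-linearity statements come from positivity. For the real part, \<open>h (of_real r)\<close> is a
  squared norm when \<open>r \<ge> 0\<close>. For the imaginary part, Cauchy-Schwarz gives \<open>\<bar>g r\<bar> \<le> f r\<close>, so \<open>f + g\<close>
  is again non-negative on the non-negative reals. Conjugate symmetry of the inner product
  excludes mixed terms.\<close>

lemma gram_function_shape:
  fixes A :: "'h::complex_inner \<Rightarrow> 'k::complex_inner"
  assumes "Modules.additive A" and gram: "\<And>x y. cinner (A x) (A y) = h (cinner x y)"
    and e: "norm (e :: 'h) = 1"
  obtains c t where "\<bar>t\<bar> \<le> c" "\<forall>s. h s = Complex (c * Re s) (t * Im s)"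
proof -
  interpret A: Modules.additive A by fact
  have h: "h (a * cnj b) = cinner (A (a *\<^sub>C e)) (A (b *\<^sub>C e))" for a b
    by (simp add: gram cinner_algebra cinner_self_unit e mult.commute)
  have h_add: "h (s + t) = h s + h t" for s t
    using h[of s 1] h[of t 1] h[of "s + t" 1]
    by (simp add: scaleC_add_left A.add cinner_add_left)
  have h_cnj: "h (cnj s) = cnj (h s)" for s
    using h[of s 1] h[of 1 s] by (simp flip: cinner_commute)
  define f where "f r = Re (h (complex_of_real r))" for r
  define g where "g r = Im (h (\<i> * complex_of_real r))" for r
  have f_add: "f (r + s) = f r + f s" and g_add: "g (r + s) = g r + g s" for r s
    by (simp_all add: f_def g_def distrib_left h_add)
  have f_g: "0 \<le> f r" "\<bar>g r\<bar> \<le> f r" if "0 \<le> r" for r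
  proof -
    \<comment> \<open>The square root distributes \<open>r\<close> evenly over both arguments of the inner product.\<close>
    define q where "q = complex_of_real (sqrt r)"
    have q: "q * cnj q = complex_of_real r" "(\<i> * q) * cnj (\<i> * q) = complex_of_real r"
      "(\<i> * q) * cnj q = \<i> * complex_of_real r"
    proof -
      have "cnj q = q" "q * q = complex_of_real r"
        using that by (simp_all add: q_def flip: of_real_mult)
      then show "q * cnj q = complex_of_real r" "(\<i> * q) * cnj (\<i> * q) = complex_of_real r"
        "(\<i> * q) * cnj q = \<i> * complex_of_real r"
        by (simp_all add: mult.assoc mult.left_commute[of q])
    qed
    have n: "(norm (A (q *\<^sub>C e)))\<^sup>2 = f r" "(norm (A ((\<i> * q) *\<^sub>C e)))\<^sup>2 = f r"
      using arg_cong[OF h[of q q], of Re] arg_cong[OF h[of "\<i> * q" "\<i> * q"], of Re]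
      unfolding q by (simp_all only: cinner_self f_def Re_complex_of_real)
    show "0 \<le> f r" unfolding n(1)[symmetric] by simp
    have "norm (A ((\<i> * q) *\<^sub>C e)) = norm (A (q *\<^sub>C e))"
      by (rule power2_eq_imp_eq) (simp_all only: n norm_ge_zero)
    then have "cmod (cinner (A ((\<i> * q) *\<^sub>C e)) (A (q *\<^sub>C e))) \<le> f r"
      using cmod_cinner_le[of "A ((\<i> * q) *\<^sub>C e)" "A (q *\<^sub>C e)"] n(1)
      by (simp add: power2_eq_square)
    then show "\<bar>g r\<bar> \<le> f r"
      using h[of "\<i> * q" q] abs_Im_le_cmod[of "h (\<i> * complex_of_real r)"]
      unfolding q g_def by simp
  qed
  have f: "f r = r * f 1" for r
    by (rule additive_nonneg_imp_homogeneous) (simp_all add: additive.intro f_add f_g)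
  have "0 \<le> f r + g r" if "0 \<le> r" for r
    using f_g(2)[OF that] by linarith
  then have sum: "f r + g r = r * (f 1 + g 1)" for r
    by (intro additive_nonneg_imp_homogeneous[of "\<lambda>r. f r + g r"])
       (simp_all add: additive.intro f_add g_add)
  have g: "g r = r * g 1" for r
    using sum[of r] f[of r] by (simp add: distrib_left)
  have "h s = Complex (f 1 * Re s) (g 1 * Im s)" for s
  proof -
    have "h s = h (complex_of_real (Re s)) + h (\<i> * complex_of_real (Im s))"
      by (simp flip: h_add complex_eq)
    moreover have "Im (h (complex_of_real (Re s))) = 0"
      using h_cnj[of "complex_of_real (Re s)"] by (simp add: complex_eq_iff)
    moreover have "h (- (\<i> * complex_of_real (Im s))) = - h (\<i> * complex_of_real (Im s))"
      by (rule additive.minus) (simp add: additive.intro h_add)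
    then have "Re (h (\<i> * complex_of_real (Im s))) = 0"
      using h_cnj[of "\<i> * complex_of_real (Im s)"] by (simp add: complex_eq_iff)
    ultimately show ?thesis
      using f[of "Re s"] g[of "Im s"] by (simp add: complex_eq_iff f_def g_def mult.commute)
  qed
  then show ?thesis using f_g(2)[of 1] by (intro that[of "g 1" "f 1"] allI) simp_all
qed

section \<open>Splitting off the complex-linear part\<close>

text \<open>Expanding the squared norm of the defect of additivity or homogeneity, and using the hypothesis
  on each term, gives a multiple of the same expression for the identity map, which is zero.\<close>

lemma clinear_if_gram:
  fixes B :: "'a::complex_inner \<Rightarrow> 'b::complex_inner"
  assumes gram: "\<And>x y. cinner (B x) (B y) = k * cinner x y"
  shows "clinear B"
  unfolding clinear_iff
proof (intro conjI allI)
  fix x y a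
  have "cinner (B (x + y) - (B x + B y)) (B (x + y) - (B x + B y)) = 0"
    by (simp add: cinner_algebra gram) (simp add: algebra_simps)
  then show "B (x + y) = B x + B y" by (simp add: cinner_self_eq_0_iff)
  have "cinner (B (a *\<^sub>C x) - a *\<^sub>C B x) (B (a *\<^sub>C x) - a *\<^sub>C B x) = 0"
    by (simp add: cinner_algebra gram)
  then show "B (a *\<^sub>C x) = a *\<^sub>C B x" by (simp add: cinner_self_eq_0_iff)
qed

lemma scaled_isometry_if_gram:
  fixes B :: "'a::complex_inner \<Rightarrow> 'b::complex_inner"
  assumes gram: "\<And>x y. cinner (B x) (B y) = complex_of_real k * cinner x y" and "k > 0"
  shows "clinear B \<and> (\<exists>(c::real) V. c > 0 \<and> clinear V \<and> isometric V \<and>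
    orthogonality_preserving V \<and> (\<forall>x. B x = c *\<^sub>R V x))"
proof -
  define V where "V x = inverse (sqrt k) *\<^sub>R B x" for x
  have V: "cinner (V x) (V y) = 1 * cinner x y" for x y
  proof -
    have "cinner (V x) (V y)
        = complex_of_real (inverse (sqrt k)) * (complex_of_real (inverse (sqrt k))
          * (complex_of_real k * cinner x y))"
      by (simp only: V_def scaleR_scaleC cinner_scaleC_left cinner_scaleC_right gram
          complex_cnj_complex_of_real)
    also have "\<dots> = complex_of_real (inverse (sqrt k) * inverse (sqrt k) * k) * cinner x y"
      by simp
    also have "inverse (sqrt k) * inverse (sqrt k) * k = 1"
      using \<open>k > 0\<close> by (simp add: field_simps)
    finally show ?thesis by simp
  qed
  have lin: "clinear V" by (rule clinear_if_gram[OF V])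
  have "V x - V y = V (x - y)" for x y
    using lin[unfolded clinear_iff, THEN conjunct1, rule_format, of "x - y" y] by simp
  moreover have "norm (V x) = norm x" for x
    using V[of x x] by (simp add: cinner_self flip: of_real_power)
  ultimately have "isometric V"
    by (simp add: isometric_def dist_norm)
  moreover have "orthogonality_preserving V"
    by (simp add: orthogonality_preserving_def V)
  moreover have "\<forall>x. B x = sqrt k *\<^sub>R V x"
    using \<open>k > 0\<close> by (simp add: V_def)
  moreover have "sqrt k > 0" using \<open>k > 0\<close> by simp
  moreover have "clinear B" by (rule clinear_if_gram[OF gram])
  ultimately show ?thesis
    using lin by (intro conjI exI[of _ "sqrt k"] exI[of _ V])
qed

text \<open>The real-linear map \<open>R\<close> removes the antilinear part \<open>A2\<close> of \<open>A\<close>. Only if \<open>c + t = 0\<close>, when the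
  complex-linear part \<open>A1\<close> vanishes, does this leave nothing, and \<open>A\<close> has to be conjugated
  instead.\<close>

lemma exists_linearizing_map:
  fixes A :: "'h::complex_inner \<Rightarrow> 'c::{complex_inner, complete_space}"
  assumes gram: "\<And>x y. cinner (A x) (A y) = Complex (c * Re (cinner x y)) (t * Im (cinner x y))"
    and "c > 0" "c + t \<ge> 0"
  obtains R :: "'c \<Rightarrow> 'c" and k where "bounded_linear R" "k > 0"
    "\<forall>x y. cinner (R (A x)) (R (A y)) = complex_of_real k * cinner x y"
proof (cases "c + t = 0")
  case True
  obtain J :: "'c \<Rightarrow> 'c" where J: "bounded_linear J" "\<forall>x y. cinner (J x) (J y) = cnj (cinner x y)"
    by (rule conjugation_exists)
  from True have "t = - c" by simp
  then show ?thesis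
    using J(1) \<open>c > 0\<close> by (intro that[of J c]) (simp_all add: J(2) gram complex_eq_iff)
next
  case False
  define A1 where "A1 x = (1/2) *\<^sub>C (A x - \<i> *\<^sub>C A (\<i> *\<^sub>C x))" for x
  define A2 where "A2 x = (1/2) *\<^sub>C (A x + \<i> *\<^sub>C A (\<i> *\<^sub>C x))" for x
  have A: "A x = A1 x + A2 x" for x
    by (simp add: A1_def A2_def scaleC_scaleC flip: scaleC_add_right)
       (simp add: scaleC_add_right flip: scaleC_add_left)
  have A1: "cinner (A1 x) (A1 y) = complex_of_real ((c + t) / 2) * cinner x y" for x y
    by (simp add: A1_def cinner_algebra gram complex_eq_iff field_simps)
  have orth: "cinner (A1 x) (A2 y) = 0" for x y
    by (simp add: A1_def A2_def cinner_algebra gram complex_eq_iff field_simps)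
  obtain P where P: "bounded_linear P"
    and P1: "\<forall>x. (\<forall>s\<in>range A2. cinner x s = 0) \<longrightarrow> P x = x"
    and P2: "\<forall>s\<in>range A2. P s = 0"
    by (rule orthogonal_projection_exists[of "range A2"])
  have "P (A x) = A1 x" for x
    using P1[THEN spec, of "A1 x"] P2 orth
    by (auto simp: A linear_add[OF bounded_linear.linear[OF P]])
  with P A1 show ?thesis
    using False \<open>c + t \<ge> 0\<close> by (intro that[of P "(c + t) / 2"]) simp_all
qed

theorem corollary2p14:
  fixes A :: "'h::complex_inner \<Rightarrow> 'k::complex_inner"
    and \<iota> :: "'k \<Rightarrow> 'c::{complex_inner, complete_space}"
  assumes "cdim_at_least 2 TYPE('h)"
    and "Modules.additive A"
    and "orthogonality_preserving A"
    and "\<exists>x. A x \<noteq> 0"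
    and "completion_embedding \<iota>"
  shows "\<exists>R :: 'c \<Rightarrow> 'c. bounded_linear R \<and> clinear (\<lambda>x. R (\<iota> (A x))) \<and>
    (\<exists>(c::real) (V :: 'h \<Rightarrow> 'c). c > 0 \<and> clinear V \<and> isometric V \<and> orthogonality_preserving V \<and>
      (\<forall>x. R (\<iota> (A x)) = c *\<^sub>R V x))"
proof -
  obtain h where h: "\<forall>x y. cinner (A x) (A y) = h (cinner x y)"
    by (rule gram_function_exists[OF assms(1-3)])
  obtain e :: 'h where e: "norm e = 1"
    using orthogonal_unit_vector_exists[OF assms(1)] by blast
  obtain c t where "\<bar>t\<bar> \<le> c" and shape: "\<forall>s. h s = Complex (c * Re s) (t * Im s)"
    by (rule gram_function_shape[OF assms(2) h[rule_format] e])
  have gram: "cinner (A x) (A y) = Complex (c * Re (cinner x y)) (t * Im (cinner x y))" for x y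
    by (simp only: h shape)
  have norm_A: "(norm (A x))\<^sup>2 = c * (norm x)\<^sup>2" for x
    using arg_cong[OF gram[of x x], of Re]
    by (simp only: cinner_self Re_complex_of_real complex.sel)
  from assms(4) obtain x where "A x \<noteq> 0" by blast
  then have "0 < c * (norm x)\<^sup>2" unfolding norm_A[symmetric] by simp
  then have "c > 0" by (simp add: zero_less_mult_iff)
  have "c + t \<ge> 0" using \<open>\<bar>t\<bar> \<le> c\<close> by linarith
  have gram_completion: "cinner (\<iota> (A x)) (\<iota> (A y)) = Complex (c * Re (cinner x y)) (t * Im (cinner x y))" for x y
    using assms(5) gram by (simp add: completion_embedding_def)
  obtain R :: "'c \<Rightarrow> 'c" and k where R: "bounded_linear R" "k > 0"
    and RA: "\<forall>x y. cinner (R (\<iota> (A x))) (R (\<iota> (A y))) = complex_of_real k * cinner x y"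
    by (rule exists_linearizing_map[where A = "\<lambda>x. \<iota> (A x)",
          OF gram_completion \<open>c > 0\<close> \<open>c + t \<ge> 0\<close>])
  then show ?thesis
    using scaled_isometry_if_gram[OF RA[rule_format] \<open>k > 0\<close>] by (intro exI[of _ R] conjI) simp_all
qed

end
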